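(* Let $(\Gamma,\preceq)$ be an ordered group, and let $(G,H)$ be a convex jump in $\Gamma$. Suppose that $G$ is a ($\preceq$-)Conradian extension of $H$. Then $H$ is normal in $G$, and the ordering induced by $\preceq$ on the quotient $G/H$ is Archimedean (and hence $G/H$ is order isomorphic to a subgroup of $(\mathbb{R},+)$).
   Context: An ordered group $(\Gamma,\preceq)$ is a group with a total order relation invariant under left multiplication. A subset $S\subseteq\Gamma$ is $\preceq$-convex if whenever $f_1\prec f\prec f_2$ with $f_1,f_2\in S$ and $f\in\Gamma$, then $f\in S$. A convex jump is a pair $(G,H)$ of distinct $\preceq$-convex subgroups of $\Gamma$ with $H\subset G$ and such that there is no $\preceq$-convex subgroup strictly between them. If $H$ is a $\preceq$-convex subgroup of $G$, the space of left cosets $G/H$ carries the total order $\leq$ defined by: $fH<gH$ if $fH \neq gH$ and $fh_1\prec gh_2$ for some (equivalently all) $h_1,h_2\in H$. The action of $G$ on $G/H$ by left translations preserves this order. When $H$ is normal, this is the induced (left-invariant) ordering on the group $G/H$. Given a group $G$ acting by order-preserving bijections on a totally ordered space $(\Omega,\leq)$, a crossing for the action is a 5-uple $(f,g,u,v,w)$ with $f,g\in G$ and $u,v,w\in\Omega$ such that: (i) $u<w<v$; (ii) $g^n u<v$ and $f^n v>u$ for every $n\in\mathbb{N}$ (positive integers); (iii) there exist $M,N\in\mathbb{N}$ with $f^N v<w<g^M u$. One says that $G$ is a $\preceq$-Conradian extension of $H$ if the action of $G$ on $G/H$ by left translations has no crossings. A group ordering is Archimedean if for all elements $a,b$ with $a\neq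 1$ there exists $n\in\mathbb{Z}$ such that $a^n\succ b$. *)

theory Defs
  imports Complex_Main "HOL-Algebra.Algebra"
begin

locale ordered_group = group G for G (structure) +
  fixes r :: "('a \<times> 'a) set"
  assumes linear_order: "linear_order_on (carrier G) r"
    and left_invariant:
      "\<lbrakk>g \<in> carrier G; (x, y) \<in> r\<rbrakk> \<Longrightarrow> (g \<otimes> x, g \<otimes> y) \<in> r"

abbreviation strict_rel :: "('a \<times> 'a) set \<Rightarrow> 'a \<Rightarrow> 'a \<Rightarrow> bool" where
  "strict_rel r x y \<equiv> (x, y) \<in> r \<and> x \<noteq> y"

definition order_convex :: "('a, 'b) monoid_scheme \<Rightarrow> ('a \<times> 'a) set \<Rightarrow> 'a set \<Rightarrow> bool" where
  "order_convex \<Gamma> r S \<longleftrightarrow> S \<subseteq> carrier \<Gamma> \<and>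
     (\<forall>f1 \<in> S. \<forall>f2 \<in> S. \<forall>f \<in> carrier \<Gamma>.
        strict_rel r f1 f \<and> strict_rel r f f2 \<longrightarrow> f \<in> S)"

definition convex_subgroup :: "('a, 'b) monoid_scheme \<Rightarrow> ('a \<times> 'a) set \<Rightarrow> 'a set \<Rightarrow> bool" where
  "convex_subgroup \<Gamma> r K \<longleftrightarrow> subgroup K \<Gamma> \<and> order_convex \<Gamma> r K"

definition convex_jump ::
  "('a, 'b) monoid_scheme \<Rightarrow> ('a \<times> 'a) set \<Rightarrow> 'a set \<Rightarrow> 'a set \<Rightarrow> bool" where
  "convex_jump \<Gamma> r G H \<longleftrightarrow>
     convex_subgroup \<Gamma> r G \<and> convex_subgroup \<Gamma> r H \<and> H \<subset> G \<and>
     \<not> (\<exists>K. convex_subgroup \<Gamma> r K \<and> H \<subset> K \<and> K \<subset> G)"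

text \<open>
  The elements of a coset \<open>fH\<close> are exactly the products \<open>fh\<close> with \<open>h \<in> H\<close>, so the
  order on cosets compares arbitrary elements of two distinct cosets. For normal \<open>H\<close> the left
  and right cosets agree, and this is then an order on the carrier of \<open>G Mod H\<close>.
\<close>

definition coset_order ::
  "('a, 'b) monoid_scheme \<Rightarrow> ('a \<times> 'a) set \<Rightarrow> 'a set \<Rightarrow> ('a set \<times> 'a set) set" where
  "coset_order G r H =
     {(A, B). A \<in> lcosets\<^bsub>G\<^esub> H \<and> B \<in> lcosets\<^bsub>G\<^esub> H \<and>
        (A = B \<or> (\<exists>x \<in> A. \<exists>y \<in> B. strict_rel r x y))}"

definition crossing ::
  "('g, 'b) monoid_scheme \<Rightarrow> ('g \<Rightarrow> 'c \<Rightarrow> 'c) \<Rightarrow> 'c set \<Rightarrow> ('c \<times> 'c) set \<Rightarrow>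
     'g \<Rightarrow> 'g \<Rightarrow> 'c \<Rightarrow> 'c \<Rightarrow> 'c \<Rightarrow> bool" where
  "crossing G act \<Omega> s f g u v w \<longleftrightarrow>
     f \<in> carrier G \<and> g \<in> carrier G \<and> u \<in> \<Omega> \<and> v \<in> \<Omega> \<and> w \<in> \<Omega> \<and>
     strict_rel s u w \<and> strict_rel s w v \<and>
     (\<forall>n::nat. n > 0 \<longrightarrow>
        strict_rel s (act (g [^]\<^bsub>G\<^esub> n) u) v \<and> strict_rel s u (act (f [^]\<^bsub>G\<^esub> n) v)) \<and>
     (\<exists>(M::nat) (N::nat). M > 0 \<and> N > 0 \<and>
        strict_rel s (act (f [^]\<^bsub>G\<^esub> N) v) w \<and> strict_rel s w (act (g [^]\<^bsub>G\<^esub> M) u))"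

definition conradian_extension ::
  "('a, 'b) monoid_scheme \<Rightarrow> ('a \<times> 'a) set \<Rightarrow> 'a set \<Rightarrow> bool" where
  "conradian_extension G r H \<longleftrightarrow>
     \<not> (\<exists>f g u v w.
          crossing G (\<lambda>a C. a <#\<^bsub>G\<^esub> C) (lcosets\<^bsub>G\<^esub> H) (coset_order G r H) f g u v w)"

locale archimedean_ordered_group = ordered_group +
  assumes archimedean:
    "\<lbrakk>a \<in> carrier G; b \<in> carrier G; a \<noteq> \<one>\<rbrakk> \<Longrightarrow> \<exists>n::int. strict_rel r b (a [^] n)"

definition real_group :: "real monoid" where
  "real_group = \<lparr>carrier = UNIV, monoid.mult = (+), one = 0\<rparr>"

text \<open>An isomorphism of ordered groups: both the group structure and the order are respected.\<close>

definition order_isomorphic_to_real_subgroup ::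
  "('a, 'b) monoid_scheme \<Rightarrow> ('a \<times> 'a) set \<Rightarrow> bool" where
  "order_isomorphic_to_real_subgroup G r \<longleftrightarrow>
     (\<exists>S h. subgroup S real_group \<and> h \<in> iso G (real_group\<lparr>carrier := S\<rparr>) \<and>
        (\<forall>x \<in> carrier G. \<forall>y \<in> carrier G. (x, y) \<in> r \<longleftrightarrow> h x \<le> h y))"

end

theory Submission
  imports Defs
begin

text \<open>
  The order on \<open>G/H\<close> pulls back to a total preorder \<open>x \<preceq> y \<longleftrightarrow> xH \<le> yH\<close> on \<open>G\<close> which is
  invariant under left multiplication and whose class of \<open>\<one>\<close> is \<open>H\<close>. The action on \<open>G/H\<close> becomes
  left multiplication, and everything reduces to the construction of a homomorphism
  \<open>\<phi> : G \<rightarrow> \<real>\<close> with \<open>x \<preceq> y \<longleftrightarrow> \<phi> x \<le> \<phi> y\<close>: its kernel is \<open>H\<close>, so \<open>H\<close> is normal, and it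
  embeds \<open>G/H\<close> as an ordered group in the reals, from which the Archimedean property is inherited.

  The absence of crossings enters through Conrad's condition alone: if \<open>f, g \<succ> \<one>\<close> then
  \<open>g \<prec> f g\<^sup>n\<close> for some \<open>n\<close>. Otherwise \<open>f\<close> and \<open>g\<close> cross at the points \<open>H\<close>, \<open>f\<inverse>gH\<close>, \<open>g\<^sup>2H\<close>
  (lemma \<open>conradian_cosets\<close>). A classical argument improves this to \<open>g \<prec> f g\<^sup>2\<close> (lemma
  \<open>conradian_square\<close>). This single inequality replaces the missing right invariance in two places.

  For \<open>b \<succ> \<one>\<close>, it shows that the elements lying below some power of \<open>b\<close> are closed under
  products, and that those \<open>f\<close> for which both \<open>f\<close> and \<open>f\<inverse>\<close> are of this kind form a convex
  subgroup. It contains \<open>H\<close> and \<open>b\<close>, hence is all of \<open>G\<close> by the definition of a jump: the powers of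
  \<open>b\<close> are cofinal (lemma \<open>archimedean_cosets\<close>).

  Together with cofinality it shows that conjugates of positive elements are positive (lemma
  \<open>conjugate_positive\<close>), so the preorder is invariant on the right too.

  The homomorphism \<open>\<phi>\<close> is then the one of Hoelder's theorem, proved here for preorders: fix
  \<open>e \<succ> \<one>\<close> and let \<open>\<phi> g\<close> be the supremum of the fractions \<open>m/n\<close> with \<open>e\<^sup>m \<preceq> g\<^sup>n\<close>. Additivity
  is obtained without first proving commutativity, because \<open>(gh)\<^sup>n\<close> always lies between
  \<open>g\<^sup>n h\<^sup>n\<close> and \<open>h\<^sup>n g\<^sup>n\<close>.
\<close>

no_notation lesspoll (infixl \<open>\<prec>\<close> 50)
no_notation subset_mset (infix \<open><#\<close> 50)

section \<open>Left-invariant preorders on groups\<close>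

text \<open>
  The carrier-restricted preorders used here are total, so the strict relation is the negation
  of the reverse weak one. Elements that are equivalent to each other need not be equal; for the
  preorder pulled back from \<open>G/H\<close> the elements equivalent to \<open>\<one>\<close> are those of \<open>H\<close>.
\<close>

locale left_preordered_group = group G for G (structure) +
  fixes le :: "'a \<Rightarrow> 'a \<Rightarrow> bool" (infix "\<preceq>" 50)
  assumes total: "\<lbrakk>x \<in> carrier G; y \<in> carrier G\<rbrakk> \<Longrightarrow> x \<preceq> y \<or> y \<preceq> x"
    and trans: "\<lbrakk>x \<in> carrier G; y \<in> carrier G; z \<in> carrier G; x \<preceq> y; y \<preceq> z\<rbrakk> \<Longrightarrow> x \<preceq> z"
    and left_mono: "\<lbrakk>g \<in> carrier G; x \<in> carrier G; y \<in> carrier G; x \<preceq> y\<rbrakk>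
      \<Longrightarrow> g \<otimes> x \<preceq> g \<otimes> y"
begin

abbreviation lt :: "'a \<Rightarrow> 'a \<Rightarrow> bool" (infix "\<prec>" 50) where
  "x \<prec> y \<equiv> \<not> y \<preceq> x"

lemma refl [simp]: "x \<in> carrier G \<Longrightarrow> x \<preceq> x"
  using total by blast

lemma less_imp_le: "\<lbrakk>x \<prec> y; x \<in> carrier G; y \<in> carrier G\<rbrakk> \<Longrightarrow> x \<preceq> y"
  using total by blast

lemma le_less_trans:
  "\<lbrakk>x \<preceq> y; y \<prec> z; x \<in> carrier G; y \<in> carrier G; z \<in> carrier G\<rbrakk> \<Longrightarrow> x \<prec> z"
  using trans by blast

lemma less_le_trans:
  "\<lbrakk>x \<prec> y; y \<preceq> z; x \<in> carrier G; y \<in> carrier G; z \<in> carrier G\<rbrakk> \<Longrightarrow> x \<prec> z"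
  using trans by blast

lemma left_mono_iff:
  assumes "g \<in> carrier G" "x \<in> carrier G" "y \<in> carrier G"
  shows "g \<otimes> x \<preceq> g \<otimes> y \<longleftrightarrow> x \<preceq> y"
  using left_mono[of g x y] left_mono[of "inv g" "g \<otimes> x" "g \<otimes> y"] assms
  by (auto simp flip: m_assoc)

lemma inv_mult_le_iff:
  assumes "g \<in> carrier G" "x \<in> carrier G" "y \<in> carrier G"
  shows "inv g \<otimes> x \<preceq> y \<longleftrightarrow> x \<preceq> g \<otimes> y"
  using left_mono_iff[of g "inv g \<otimes> x" y] assms by (simp flip: m_assoc)

lemma le_inv_mult_iff:
  assumes "g \<in> carrier G" "x \<in> carrier G" "y \<in> carrier G"
  shows "x \<preceq> inv g \<otimes> y \<longleftrightarrow> g \<otimes> x \<preceq> y"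
  using left_mono_iff[of g x "inv g \<otimes> y"] assms by (simp flip: m_assoc)

lemma le_mult_right_iff:
  assumes "x \<in> carrier G" "y \<in> carrier G"
  shows "x \<preceq> x \<otimes> y \<longleftrightarrow> \<one> \<preceq> y" "x \<otimes> y \<preceq> x \<longleftrightarrow> y \<preceq> \<one>"
  using left_mono_iff[of x \<one> y] left_mono_iff[of x y \<one>] assms by auto

lemma one_le_pow:
  assumes "x \<in> carrier G" "\<one> \<preceq> x"
  shows "\<one> \<preceq> x [^] (n::nat)"
proof (induction n)
  case (Suc n)
  then show ?case
    using trans[of \<one> "x [^] n" "x [^] Suc n"] le_mult_right_iff[of "x [^] n" x] assms by simp
qed (simp add: assms)

lemma pow_le_one:
  assumes "x \<in> carrier G" "x \<preceq> \<one>"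
  shows "x [^] (n::nat) \<preceq> \<one>"
proof (induction n)
  case (Suc n)
  then show ?case
    using trans[of "x [^] Suc n" "x [^] n" \<one>] le_mult_right_iff[of "x [^] n" x] assms by simp
qed (simp add: assms)

lemma pow_mono_exponent:
  assumes "x \<in> carrier G" "\<one> \<preceq> x" "m \<le> n"
  shows "x [^] (m::nat) \<preceq> x [^] n"
  using le_mult_right_iff[of "x [^] m" "x [^] (n - m)"] one_le_pow[of x "n - m"] assms
  by (simp add: nat_pow_mult)

lemma one_less_pow:
  assumes "x \<in> carrier G" "\<one> \<prec> x" "0 < n"
  shows "\<one> \<prec> x [^] (n::nat)"
  using less_le_trans[OF assms(2), of "x [^] n"] pow_mono_exponent[of x 1 n] less_imp_le[OF assms(2)] assms
  by simp

end


section \<open>Groups with Conrad's property\<close>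

locale conradian_group = left_preordered_group +
  assumes conradian: "\<lbrakk>f \<in> carrier G; g \<in> carrier G; \<one> \<prec> f; \<one> \<prec> g\<rbrakk>
    \<Longrightarrow> \<exists>n::nat. g \<prec> f \<otimes> g [^] n"
begin

text \<open>
  If \<open>f g\<^sup>2 \<preceq> g\<close>, then \<open>h = f g\<close> satisfies \<open>h g \<preceq> g\<close>, and so all its powers satisfy
  \<open>h\<^sup>n \<prec> h\<^sup>n g \<preceq> g\<close>. Multiplying by \<open>f\<close> gives \<open>f h\<^sup>n \<prec> h\<close> for all \<open>n\<close>, against Conrad's
  condition for the pair \<open>f, h\<close>.
\<close>

lemma conradian_square:
  assumes fg: "f \<in> carrier G" "g \<in> carrier G" "\<one> \<prec> f" "\<one> \<prec> g"
  shows "g \<prec> f \<otimes> (g \<otimes> g)"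
proof
  define h where "h = f \<otimes> g"
  assume "f \<otimes> (g \<otimes> g) \<preceq> g"
  then have hg: "h \<otimes> g \<preceq> g" and hG: "h \<in> carrier G" using fg by (auto simp: h_def m_assoc)
  have "f \<prec> h" using le_mult_right_iff[of f g] fg by (simp add: h_def)
  then have h1: "\<one> \<prec> h" using le_less_trans[of \<one> f h] less_imp_le[OF fg(3)] fg hG by simp
  have hn: "h [^] n \<otimes> g \<preceq> g" for n :: nat
  proof (induction n)
    case (Suc n)
    have "h [^] n \<otimes> (h \<otimes> g) \<preceq> h [^] n \<otimes> g" using hg hG fg by (simp add: left_mono)
    then show ?case using Suc trans[of "h [^] n \<otimes> (h \<otimes> g)" "h [^] n \<otimes> g" g] hG fg
      by (simp add: m_assoc)
  qed (use fg in simp)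
  obtain n :: nat where "h \<prec> f \<otimes> h [^] n" using conradian[OF fg(1) hG fg(3) h1] by blast
  then have "g \<prec> h [^] n" using left_mono_iff[of f "h [^] n" g] fg hG by (simp add: h_def)
  moreover have "h [^] n \<preceq> h [^] n \<otimes> g"
    using le_mult_right_iff(1)[of "h [^] n" g] less_imp_le[OF fg(4)] fg hG by simp
  ultimately show False using trans[OF _ _ _ _ hn[of n]] fg hG by auto
qed

definition dominated :: "'a \<Rightarrow> 'a set" where
  "dominated b = {y \<in> carrier G. \<exists>m::nat. y \<preceq> b [^] m}"

lemma dominatedI: "\<lbrakk>y \<in> carrier G; y \<preceq> b [^] (m::nat)\<rbrakk> \<Longrightarrow> y \<in> dominated b"
  by (auto simp: dominated_def)

lemma dominatedE:
  assumes "y \<in> dominated b" "b \<in> carrier G" "\<one> \<prec> b"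
  obtains m :: nat where "0 < m" "y \<preceq> b [^] m" "y \<in> carrier G"
proof -
  from assms obtain m :: nat where m: "y \<in> carrier G" "y \<preceq> b [^] m"
    by (auto simp: dominated_def)
  have "y \<preceq> b [^] Suc m"
    using trans[OF _ _ _ m(2)] pow_mono_exponent[of b m "Suc m"] less_imp_le[OF assms(3)] assms m
    by simp
  then show ?thesis using that[of "Suc m"] m by simp
qed

lemma dominated_down:
  assumes "z \<in> dominated b" "y \<in> carrier G" "y \<preceq> z" "b \<in> carrier G"
  shows "y \<in> dominated b"
proof -
  obtain m :: nat where m: "z \<in> carrier G" "z \<preceq> b [^] m"
    using assms(1) by (auto simp: dominated_def)
  then have "y \<preceq> b [^] m" using trans[of y z "b [^] m"] assms by simp
  then show ?thesis using dominatedI assms by blast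
qed

text \<open>
  By left invariance it suffices to bound \<open>f g\<close> for a power \<open>g\<close> of \<open>b\<close>. With a power \<open>c\<close> of \<open>b\<close>
  above \<open>f\<close>, the element \<open>f\<inverse>c\<^sup>2\<close> is positive (the square makes this strict), so
  \<open>g \<prec> f\<inverse>c\<^sup>2g\<^sup>2\<close>, that is, \<open>f g \<prec> c\<^sup>2g\<^sup>2\<close>, again a power of \<open>b\<close>.
\<close>

lemma dominated_mult:
  assumes b: "b \<in> carrier G" "\<one> \<prec> b" and f: "f \<in> dominated b" and y: "y \<in> dominated b"
  shows "f \<otimes> y \<in> dominated b"
proof -
  obtain M :: nat where M: "0 < M" "f \<preceq> b [^] M" and fG: "f \<in> carrier G"
    using dominatedE f b by blast
  obtain k :: nat where k: "0 < k" "y \<preceq> b [^] k" and yG: "y \<in> carrier G"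
    using dominatedE y b by blast
  define c where "c = b [^] M"
  define g where "g = b [^] k"
  have cg: "c \<in> carrier G" "g \<in> carrier G" "\<one> \<prec> c" "\<one> \<prec> g"
    using one_less_pow[of b] b M k by (auto simp: c_def g_def)
  have "\<one> \<preceq> inv f \<otimes> c" using le_inv_mult_iff[of f \<one> c] M fG cg by (simp add: c_def)
  moreover have "inv f \<otimes> c \<prec> inv f \<otimes> c \<otimes> c"
    using le_mult_right_iff(2)[of "inv f \<otimes> c" c] fG cg by simp
  ultimately have "\<one> \<prec> inv f \<otimes> c \<otimes> c"
    using le_less_trans[of \<one> "inv f \<otimes> c"] fG cg by simp
  then have "g \<prec> inv f \<otimes> c \<otimes> c \<otimes> (g \<otimes> g)"
    by (rule conradian_square[rotated 2]) (use cg fG in auto)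
  then have "g \<prec> inv f \<otimes> (c \<otimes> c \<otimes> (g \<otimes> g))" using cg fG by (simp add: m_assoc)
  then have "f \<otimes> g \<prec> c \<otimes> c \<otimes> (g \<otimes> g)"
    using inv_mult_le_iff[of f "c \<otimes> c \<otimes> (g \<otimes> g)" g] cg fG by simp
  also have "c \<otimes> c \<otimes> (g \<otimes> g) = b [^] (M + M + (k + k))"
    using b by (simp add: c_def g_def nat_pow_mult)
  finally have "f \<otimes> g \<in> dominated b"
    using less_imp_le b fG cg dominatedI[of "f \<otimes> g"] by blast
  moreover have "f \<otimes> y \<preceq> f \<otimes> g" using left_mono k fG yG cg by (simp add: g_def)
  ultimately show ?thesis using dominated_down b fG yG by simp
qed

text \<open>
  Left multiplication by \<open>f\<inverse>\<close> with \<open>f \<succeq> \<one>\<close> could a priori move elements upwards, as no right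
  invariance is available. But \<open>f b \<succ> \<one>\<close>, so \<open>g \<prec> f b g\<^sup>2\<close> for every power \<open>g\<close> of \<open>b\<close>, which
  bounds \<open>f\<inverse>g\<close> by \<open>b g\<^sup>2\<close>.
\<close>

lemma dominated_inv_mult:
  assumes b: "b \<in> carrier G" "\<one> \<prec> b"
    and f: "f \<in> carrier G" "\<one> \<preceq> f" and y: "y \<in> dominated b"
  shows "inv f \<otimes> y \<in> dominated b"
proof -
  obtain k :: nat where k: "0 < k" "y \<preceq> b [^] k" and yG: "y \<in> carrier G"
    using dominatedE y b by blast
  define g where "g = b [^] k"
  have g: "g \<in> carrier G" "\<one> \<prec> g" using one_less_pow[of b] b k by (auto simp: g_def)
  have "f \<prec> f \<otimes> b" using le_mult_right_iff(2)[of f b] f b by simp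
  then have "\<one> \<prec> f \<otimes> b" using le_less_trans[of \<one> f] f b by simp
  then have "g \<prec> f \<otimes> b \<otimes> (g \<otimes> g)"
    by (rule conradian_square[rotated 2]) (use g f b in auto)
  then have "g \<prec> f \<otimes> (b \<otimes> (g \<otimes> g))" using f b g by (simp add: m_assoc)
  then have "inv f \<otimes> g \<prec> b \<otimes> (g \<otimes> g)"
    using le_inv_mult_iff[of f "b \<otimes> (g \<otimes> g)" g] f b g by simp
  also have "b \<otimes> (g \<otimes> g) = b [^] Suc (k + k)"
    using b by (simp only: g_def nat_pow_mult nat_pow_Suc2)
  finally have "inv f \<otimes> g \<in> dominated b"
    using less_imp_le b f g dominatedI[of "inv f \<otimes> g"] by blast
  moreover have "inv f \<otimes> y \<preceq> inv f \<otimes> g" using left_mono k f yG g by (simp add: g_def)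
  ultimately show ?thesis using dominated_down b f yG by simp
qed

definition dominated_subgroup :: "'a \<Rightarrow> 'a set" where
  "dominated_subgroup b = {f \<in> carrier G. f \<in> dominated b \<and> inv f \<in> dominated b}"

lemma dominated_subgroup_is_subgroup:
  assumes b: "b \<in> carrier G" "\<one> \<prec> b"
  shows "subgroup (dominated_subgroup b) G"
proof (rule subgroupI)
  have "\<one> \<in> dominated_subgroup b"
    using dominatedI[of \<one> b 0] by (simp add: dominated_subgroup_def)
  then show "dominated_subgroup b \<noteq> {}" by blast
qed (use dominated_mult[OF b] in \<open>auto simp: dominated_subgroup_def inv_mult_group\<close>)

text \<open>
  For \<open>x \<preceq> y \<preceq> z\<close>, the delicate point is a bound for \<open>y\<inverse>\<close>: it equals \<open>q\<inverse>x\<inverse>\<close> with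
  \<open>q = x\<inverse>y \<succeq> \<one>\<close>, so the preceding lemma applies.
\<close>

lemma dominated_subgroup_convex:
  assumes b: "b \<in> carrier G" "\<one> \<prec> b"
    and x: "x \<in> dominated_subgroup b" and z: "z \<in> dominated_subgroup b"
    and y: "y \<in> carrier G" "x \<preceq> y" "y \<preceq> z"
  shows "y \<in> dominated_subgroup b"
proof -
  have xG: "x \<in> carrier G" using x by (simp add: dominated_subgroup_def)
  have "y \<in> dominated b" using z y b dominated_down by (auto simp: dominated_subgroup_def)
  moreover have "\<one> \<preceq> inv x \<otimes> y" using le_inv_mult_iff[of x \<one> y] xG y by simp
  then have "inv (inv x \<otimes> y) \<otimes> inv x \<in> dominated b"
    using dominated_inv_mult[OF b] x xG y by (simp add: dominated_subgroup_def)
  then have "inv y \<in> dominated b" using xG y by (simp add: inv_mult_group m_assoc)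
  ultimately show ?thesis using y by (simp add: dominated_subgroup_def)
qed

lemma base_in_dominated_subgroup:
  assumes b: "b \<in> carrier G" "\<one> \<prec> b"
  shows "b \<in> dominated_subgroup b"
proof -
  have "inv b \<preceq> \<one>" using inv_mult_le_iff[of b \<one> \<one>] less_imp_le[OF b(2)] b by simp
  then show ?thesis
    using dominatedI[of b b 1] dominatedI[of "inv b" b 0] b by (simp add: dominated_subgroup_def)
qed

end

locale archimedean_conradian_group = conradian_group +
  assumes archimedean: "\<lbrakk>b \<in> carrier G; f \<in> carrier G; \<one> \<prec> b\<rbrakk> \<Longrightarrow> \<exists>n::nat. f \<prec> b [^] n"
begin

text \<open>
  Suppose \<open>h = g p g\<inverse> \<preceq> \<one>\<close> and choose a power \<open>q\<close> of \<open>p\<close> above \<open>g\<close>. As the powers of \<open>h\<close> do not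
  exceed \<open>\<one>\<close>, each \<open>h\<^sup>-\<^sup>k q\<close> is positive, and \<open>q \<prec> (h\<^sup>-\<^sup>k q) q\<^sup>2\<close> keeps all
  \<open>h\<^sup>k q\<close> below \<open>q\<^sup>3\<close>. But \<open>h\<^sup>k q \<succeq> h\<^sup>k g = g p\<^sup>k\<close>, and \<open>g p\<^sup>k\<close> is eventually above \<open>q\<^sup>3\<close>.
  The case in which \<open>h\<close> is equivalent to \<open>\<one>\<close> is the normality of the class of \<open>\<one>\<close>.
\<close>

lemma conjugate_positive:
  assumes p: "p \<in> carrier G" "\<one> \<prec> p" and g: "g \<in> carrier G"
  shows "\<one> \<prec> g \<otimes> p \<otimes> inv g"
proof
  define h where "h = g \<otimes> p \<otimes> inv g"
  assume "g \<otimes> p \<otimes> inv g \<preceq> \<one>"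
  then have h: "h \<in> carrier G" "h \<preceq> \<one>" using p g by (auto simp: h_def)
  have conj: "h [^] k \<otimes> g = g \<otimes> p [^] k" for k :: nat
  proof (induction k)
    case (Suc k)
    have "h [^] Suc k \<otimes> g = h [^] k \<otimes> g \<otimes> p" using h p g by (simp add: h_def m_assoc)
    then show ?case using Suc p g by (simp add: m_assoc)
  qed (use g in simp)
  obtain j :: nat where j: "g \<prec> p [^] j" using archimedean p g by blast
  define q where "q = p [^] Suc j"
  have q: "q \<in> carrier G" "\<one> \<prec> q" using p one_less_pow[of p "Suc j"] by (auto simp: q_def)
  have "p [^] j \<preceq> q"
    using pow_mono_exponent[of p j "Suc j"] p less_imp_le[OF p(2)] by (simp add: q_def)
  then have gq: "g \<preceq> q" using trans[of g "p [^] j" q] less_imp_le[OF j] p g q by simp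
  obtain k :: nat where k: "inv g \<otimes> (q \<otimes> (q \<otimes> q)) \<prec> p [^] k"
    using archimedean[of p "inv g \<otimes> (q \<otimes> (q \<otimes> q))"] p g q by auto
  have "h [^] k \<prec> q" using le_less_trans[OF pow_le_one[OF h]] h q by simp
  then have "\<one> \<prec> inv (h [^] k) \<otimes> q"
    using inv_mult_le_iff[of "h [^] k" q \<one>] h q by simp
  then have "q \<prec> inv (h [^] k) \<otimes> q \<otimes> (q \<otimes> q)"
    by (rule conradian_square[rotated 2]) (use h q in auto)
  then have "q \<prec> inv (h [^] k) \<otimes> (q \<otimes> (q \<otimes> q))" using h q by (simp add: m_assoc)
  then have upper: "h [^] k \<otimes> q \<prec> q \<otimes> (q \<otimes> q)"
    using inv_mult_le_iff[of "h [^] k" "q \<otimes> (q \<otimes> q)" q] h q by simp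
  have above: "q \<otimes> (q \<otimes> q) \<prec> g \<otimes> p [^] k"
    using k le_inv_mult_iff[of g "p [^] k" "q \<otimes> (q \<otimes> q)"] p g q by simp
  have "g \<otimes> p [^] k \<preceq> h [^] k \<otimes> q"
    using left_mono[of "h [^] k" g q] gq h g q by (simp add: conj)
  then have "q \<otimes> (q \<otimes> q) \<prec> h [^] k \<otimes> q"
    using less_le_trans[OF above, of "h [^] k \<otimes> q"] h p g q by simp
  with upper show False
    using total[of "h [^] k \<otimes> q" "q \<otimes> (q \<otimes> q)"] h q by simp
qed

lemma right_mono:
  assumes "g \<in> carrier G" "x \<in> carrier G" "y \<in> carrier G" "x \<preceq> y"
  shows "x \<otimes> g \<preceq> y \<otimes> g"
proof (rule ccontr)
  assume "y \<otimes> g \<prec> x \<otimes> g"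
  then have "\<one> \<prec> inv (y \<otimes> g) \<otimes> (x \<otimes> g)"
    using inv_mult_le_iff[of "y \<otimes> g" "x \<otimes> g" \<one>] assms by simp
  then have "\<one> \<prec> g \<otimes> (inv (y \<otimes> g) \<otimes> (x \<otimes> g)) \<otimes> inv g"
    using assms by (intro conjugate_positive) auto
  also have "g \<otimes> (inv (y \<otimes> g) \<otimes> (x \<otimes> g)) \<otimes> inv g = inv y \<otimes> x"
    using assms by (simp add: inv_mult_group m_assoc) (simp flip: m_assoc)
  finally show False using inv_mult_le_iff[of y x \<one>] assms by simp
qed

end


section \<open>Hoelder's embedding\<close>

locale archimedean_bipreordered_group = left_preordered_group +
  assumes right_mono: "\<lbrakk>g \<in> carrier G; x \<in> carrier G; y \<in> carrier G; x \<preceq> y\<rbrakk>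
      \<Longrightarrow> x \<otimes> g \<preceq> y \<otimes> g"
    and archimedean: "\<lbrakk>b \<in> carrier G; f \<in> carrier G; \<one> \<prec> b\<rbrakk> \<Longrightarrow> \<exists>n::nat. f \<prec> b [^] n"
begin

lemma mult_mono:
  assumes "x \<in> carrier G" "y \<in> carrier G" "x' \<in> carrier G" "y' \<in> carrier G"
    and "x \<preceq> x'" "y \<preceq> y'"
  shows "x \<otimes> y \<preceq> x' \<otimes> y'"
  using trans[of "x \<otimes> y" "x' \<otimes> y" "x' \<otimes> y'"] right_mono left_mono assms by simp

lemma pow_mono:
  assumes "x \<in> carrier G" "y \<in> carrier G" "x \<preceq> y"
  shows "x [^] (n::nat) \<preceq> y [^] n"
  by (induction n) (use assms in \<open>auto intro: mult_mono\<close>)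

text \<open>
  Both inequalities follow by induction from \<open>g (hg)\<^sup>n h = (gh)\<^sup>n\<^sup>+\<^sup>1\<close>, since exchanging
  \<open>(gh)\<^sup>n\<close> for \<open>(hg)\<^sup>n\<close> only increases a product.
\<close>

lemma pow_mult_between:
  assumes gh: "g \<in> carrier G" "h \<in> carrier G" and le: "g \<otimes> h \<preceq> h \<otimes> g"
  shows "g [^] n \<otimes> h [^] n \<preceq> (g \<otimes> h) [^] (n::nat)" (is "?lower n")
    and "(h \<otimes> g) [^] n \<preceq> h [^] n \<otimes> g [^] n" (is "?upper n")
proof -
  have swap: "a \<otimes> (b \<otimes> a) [^] n \<otimes> b = (a \<otimes> b) [^] Suc n"
    if "a \<in> carrier G" "b \<in> carrier G" for a b and n :: nat
  proof (induction n)
    case (Suc n)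
    have "a \<otimes> (b \<otimes> a) [^] Suc n \<otimes> b = (a \<otimes> (b \<otimes> a) [^] n \<otimes> b) \<otimes> (a \<otimes> b)"
      using that by (simp add: m_assoc)
    then show ?case using Suc by simp
  qed (use that in simp)
  have pows: "(g \<otimes> h) [^] n \<preceq> (h \<otimes> g) [^] n" for n :: nat using pow_mono gh le by simp
  have step: "a [^] Suc n \<otimes> b [^] Suc n = a \<otimes> (a [^] n \<otimes> b [^] n) \<otimes> b"
    if "a \<in> carrier G" "b \<in> carrier G" for a b and n :: nat
    using that by (simp only: nat_pow_Suc2[of a]) (simp add: m_assoc)
  show "?lower n"
  proof (induction n)
    case (Suc n)
    have "g [^] n \<otimes> h [^] n \<preceq> (h \<otimes> g) [^] n"
      by (rule trans[OF _ _ _ Suc pows]) (use gh in auto)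
    then have "g \<otimes> (g [^] n \<otimes> h [^] n) \<otimes> h \<preceq> g \<otimes> (h \<otimes> g) [^] n \<otimes> h"
      using gh by (intro mult_mono) auto
    then show ?case by (simp only: step swap gh)
  qed simp
  show "?upper n"
  proof (induction n)
    case (Suc n)
    have "(g \<otimes> h) [^] n \<preceq> h [^] n \<otimes> g [^] n"
      by (rule trans[OF _ _ _ pows Suc]) (use gh in auto)
    then have "h \<otimes> (g \<otimes> h) [^] n \<otimes> g \<preceq> h \<otimes> (h [^] n \<otimes> g [^] n) \<otimes> g"
      using gh by (intro mult_mono) auto
    then show ?case by (simp only: step swap gh)
  qed simp
qed

context
  fixes e
  assumes e: "e \<in> carrier G" "\<one> \<prec> e"
begin

lemma unit_int_pow_le_iff: "e [^] (m::int) \<preceq> e [^] (n::int) \<longleftrightarrow> m \<le> n"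
proof -
  have mono: "e [^] m \<preceq> e [^] n" if "m \<le> n" for m n :: int
    using le_mult_right_iff(1)[of "e [^] m" "e [^] (n - m)"] one_le_pow[of e "nat (n - m)"]
      less_imp_le[OF e(2)] e that by (simp add: int_pow_mult[symmetric] pow_nat)
  have "e [^] n \<prec> e [^] (n + 1)" for n :: int
    using le_mult_right_iff(2)[of "e [^] n" e] e by (simp add: int_pow_mult)
  then have "e [^] n \<prec> e [^] m" if "n < m" for m n :: int
    using less_le_trans[OF _ mono[of "n + 1" m]] e that by simp
  then show ?thesis using mono by (meson not_le)
qed

lemma floor_exists:
  assumes x: "x \<in> carrier G"
  obtains a :: int where "e [^] a \<preceq> x" "x \<preceq> e [^] (a + 1)"
proof -
  obtain k :: nat where k: "x \<prec> e [^] k" using archimedean e x by blast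
  obtain l :: nat where l: "inv x \<prec> e [^] l" using archimedean e x by blast
  have "x \<otimes> inv x \<preceq> x \<otimes> e [^] l" using left_mono[OF x _ _ less_imp_le[OF l]] x e by simp
  then have "\<one> \<otimes> inv (e [^] l) \<preceq> x \<otimes> e [^] l \<otimes> inv (e [^] l)"
    using right_mono[of "inv (e [^] l)" \<one> "x \<otimes> e [^] l"] x e by simp
  then have lower: "e [^] (- int l) \<preceq> x" using x e by (simp add: m_assoc int_pow_neg_int)
  \<comment> \<open>Shifting by \<open>l\<close> turns the search for the least integer exponent above \<open>x\<close> into one in \<open>nat\<close>.\<close>
  define n where "n = (LEAST n::nat. x \<prec> e [^] (int n - int l))"
  have "x \<prec> e [^] (int (k + l) - int l)" using k by (simp add: int_pow_int)
  then have n: "x \<prec> e [^] (int n - int l)" unfolding n_def by (rule LeastI)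
  then have "n \<noteq> 0" using lower by (cases n) auto
  then have "\<not> x \<prec> e [^] (int (n - 1) - int l)"
    using not_less_Least[of "n - 1" "\<lambda>n. x \<prec> e [^] (int n - int l)"] by (simp add: n_def)
  then show ?thesis
    using that[of "int (n - 1) - int l"] n less_imp_le[OF n] x e \<open>n \<noteq> 0\<close>
    by (simp add: of_nat_diff)
qed

text \<open>
  This is Hoelder's map, normalised to take the value 1 at \<open>e\<close>.
\<close>

definition slope :: "'a \<Rightarrow> real" where
  "slope g = Sup {of_int m / of_nat n | (m::int) (n::nat). 0 < n \<and> e [^] m \<preceq> g [^] n}"

text \<open>
  Raising \<open>e\<^sup>m \<preceq> g\<^sup>n\<close> to the power \<open>k\<close> and \<open>g\<^sup>k \<preceq> e\<^sup>l\<close> to the power \<open>n\<close> compares both with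
  \<open>g\<^sup>n\<^sup>k\<close>. Hence the fractions from below and from above form a cut with value \<open>slope g\<close>.
\<close>

lemma slope_cut:
  assumes g: "g \<in> carrier G" and n: "0 < n" "e [^] m \<preceq> g [^] n"
    and k: "0 < k" "g [^] k \<preceq> e [^] l"
  shows "of_int m / real n \<le> of_int l / real k"
proof -
  have "(e [^] m) [^] k \<preceq> (g [^] n) [^] k" using pow_mono n g e by simp
  moreover have "(g [^] k) [^] n \<preceq> (e [^] l) [^] n" using pow_mono k g e by simp
  ultimately have "(e [^] m) [^] k \<preceq> (e [^] l) [^] n"
    using trans[of "(e [^] m) [^] k" "(g [^] n) [^] k" "(e [^] l) [^] n"] g e
    by (simp add: nat_pow_pow mult.commute)
  then have "e [^] (m * int k) \<preceq> e [^] (l * int n)"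
    using e by (simp add: int_pow_pow flip: int_pow_int)
  then have "m * int k \<le> l * int n" by (simp add: unit_int_pow_le_iff)
  then have "real_of_int (m * int k) \<le> real_of_int (l * int n)" by linarith
  then show ?thesis using n k by (simp add: field_simps)
qed

lemma slope_bounds:
  assumes g: "g \<in> carrier G" and n: "0 < n"
  shows "e [^] m \<preceq> g [^] n \<Longrightarrow> of_int m \<le> real n * slope g"
    and "g [^] n \<preceq> e [^] m \<Longrightarrow> real n * slope g \<le> of_int m"
proof -
  let ?S = "{of_int m / of_nat n :: real | (m::int) (n::nat). 0 < n \<and> e [^] m \<preceq> g [^] n}"
  obtain a :: int where a: "e [^] a \<preceq> g" "g \<preceq> e [^] (a + 1)" using floor_exists g by blast
  have upper: "s \<le> of_int l / real k" if "s \<in> ?S" "0 < k" "g [^] k \<preceq> e [^] l" for s l k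
    using that slope_cut[OF g] by blast
  have bdd: "bdd_above ?S"
    using upper[of _ 1 "a + 1"] a(2) g by (intro bdd_aboveI[of _ "of_int (a + 1)"]) auto
  have "real_of_int a / real 1 \<in> ?S" using a(1) g
    by (intro CollectI exI[of _ a] exI[of _ 1]) simp
  then have ne: "?S \<noteq> {}" by blast
  {
    assume "e [^] m \<preceq> g [^] n"
    then have "of_int m / real n \<le> slope g"
      unfolding slope_def using n bdd by (intro cSup_upper) auto
    then show "of_int m \<le> real n * slope g" using n by (simp add: field_simps)
  next
    assume "g [^] n \<preceq> e [^] m"
    then have "slope g \<le> of_int m / real n"
      unfolding slope_def using n ne upper by (intro cSup_least) auto
    then show "real n * slope g \<le> of_int m" using n by (simp add: field_simps)
  }
qed

text \<open>
  If \<open>e\<^sup>a \<preceq> g\<^sup>n \<preceq> e\<^sup>a\<^sup>+\<^sup>1\<close> and \<open>e\<^sup>b \<preceq> h\<^sup>n \<preceq> e\<^sup>b\<^sup>+\<^sup>1\<close>, then both \<open>g\<^sup>n h\<^sup>n\<close> and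
  \<open>h\<^sup>n g\<^sup>n\<close>, and therefore \<open>(gh)\<^sup>n\<close>, lie between \<open>e\<^sup>a\<^sup>+\<^sup>b\<close> and \<open>e\<^sup>a\<^sup>+\<^sup>b\<^sup>+\<^sup>2\<close>. So \<open>n\<close> times the
  defect of additivity is at most 2 in absolute value, for every \<open>n\<close>.
\<close>

lemma slope_mult:
  assumes g: "g \<in> carrier G" and h: "h \<in> carrier G"
  shows "slope (g \<otimes> h) = slope g + slope h"
proof -
  have bound: "real n * \<bar>slope (g \<otimes> h) - slope g - slope h\<bar> \<le> 2" if n: "0 < n" for n :: nat
  proof -
    obtain a :: int where a: "e [^] a \<preceq> g [^] n" "g [^] n \<preceq> e [^] (a + 1)"
      using floor_exists[of "g [^] n"] g by auto
    obtain b :: int where b: "e [^] b \<preceq> h [^] n" "h [^] n \<preceq> e [^] (b + 1)"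
      using floor_exists[of "h [^] n"] h by auto
    have gh: "e [^] (a + b) \<preceq> g [^] n \<otimes> h [^] n" "g [^] n \<otimes> h [^] n \<preceq> e [^] (a + b + 2)"
      using mult_mono[OF _ _ _ _ a(1) b(1)] mult_mono[OF _ _ _ _ a(2) b(2)] e g h
      by (simp_all add: algebra_simps flip: int_pow_mult)
    have hg: "e [^] (a + b) \<preceq> h [^] n \<otimes> g [^] n" "h [^] n \<otimes> g [^] n \<preceq> e [^] (a + b + 2)"
      using mult_mono[OF _ _ _ _ b(1) a(1)] mult_mono[OF _ _ _ _ b(2) a(2)] e g h
      by (simp_all add: algebra_simps flip: int_pow_mult)
    have "e [^] (a + b) \<preceq> (g \<otimes> h) [^] n \<and> (g \<otimes> h) [^] n \<preceq> e [^] (a + b + 2)"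
    proof (cases "g \<otimes> h \<preceq> h \<otimes> g")
      case True
      have "(g \<otimes> h) [^] n \<preceq> (h \<otimes> g) [^] n" using pow_mono True g h by simp
      then have "(g \<otimes> h) [^] n \<preceq> h [^] n \<otimes> g [^] n"
        by (rule trans[rotated 3, OF _ pow_mult_between(2)[OF g h True]]) (use g h in auto)
      then show ?thesis
        using trans[OF _ _ _ gh(1) pow_mult_between(1)[OF g h True]]
          trans[OF _ _ _ _ hg(2), of "(g \<otimes> h) [^] n"] e g h by simp
    next
      case False
      then have le: "h \<otimes> g \<preceq> g \<otimes> h" using total g h by blast
      have "(h \<otimes> g) [^] n \<preceq> (g \<otimes> h) [^] n" using pow_mono le g h by simp
      then have "h [^] n \<otimes> g [^] n \<preceq> (g \<otimes> h) [^] n"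
        by (rule trans[rotated 3, OF pow_mult_between(1)[OF h g le]]) (use g h in auto)
      then show ?thesis
        using trans[OF _ _ _ pow_mult_between(2)[OF h g le] gh(2)]
          trans[OF _ _ _ hg(1), of "(g \<otimes> h) [^] n"] e g h by simp
    qed
    then have "of_int (a + b) \<le> real n * slope (g \<otimes> h)"
        "real n * slope (g \<otimes> h) \<le> of_int (a + b + 2)"
      using slope_bounds[of "g \<otimes> h" n] n g h by blast+
    moreover have "of_int a \<le> real n * slope g" "real n * slope g \<le> of_int (a + 1)"
      using slope_bounds[OF g n] a by blast+
    moreover have "of_int b \<le> real n * slope h" "real n * slope h \<le> of_int (b + 1)"
      using slope_bounds[OF h n] b by blast+
    ultimately have "\<bar>real n * (slope (g \<otimes> h) - slope g - slope h)\<bar> \<le> 2"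
      by (simp add: algebra_simps)
    then show ?thesis by (simp add: abs_mult)
  qed
  have "\<bar>slope (g \<otimes> h) - slope g - slope h\<bar> = 0"
  proof (rule ccontr)
    assume "\<bar>slope (g \<otimes> h) - slope g - slope h\<bar> \<noteq> 0"
    then have "0 < \<bar>slope (g \<otimes> h) - slope g - slope h\<bar>" by linarith
    then obtain n :: nat where "2 < real n * \<bar>slope (g \<otimes> h) - slope g - slope h\<bar>"
      using reals_Archimedean3 by blast
    then show False using bound[of n] by (cases "n = 0") auto
  qed
  then show ?thesis by simp
qed

lemma slope_le_iff:
  assumes x: "x \<in> carrier G" and y: "y \<in> carrier G"
  shows "slope x \<le> slope y \<longleftrightarrow> x \<preceq> y"
proof
  assume "x \<preceq> y"
  then have "e [^] (0::int) \<preceq> (inv x \<otimes> y) [^] (1::nat)"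
    using le_inv_mult_iff[of x \<one> y] x y by simp
  then have "0 \<le> slope (inv x \<otimes> y)" using slope_bounds(1)[of "inv x \<otimes> y" 1 0] x y by simp
  moreover have "slope y = slope x + slope (inv x \<otimes> y)"
    using slope_mult[of x "inv x \<otimes> y"] x y by (simp flip: m_assoc)
  ultimately show "slope x \<le> slope y" by simp
next
  assume le: "slope x \<le> slope y"
  show "x \<preceq> y"
  proof (rule ccontr)
    assume "y \<prec> x"
    define g where "g = inv y \<otimes> x"
    have g: "g \<in> carrier G" "\<one> \<prec> g"
      using \<open>y \<prec> x\<close> inv_mult_le_iff[of y x \<one>] x y by (auto simp: g_def)
    obtain n :: nat where n: "e \<prec> g [^] n" using archimedean g e by blast
    then have "n \<noteq> 0" using less_imp_le[OF e(2)] e by (cases n) auto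
    then have "1 \<le> real n * slope g"
      using slope_bounds(1)[of g n 1] less_imp_le[OF n] g e by simp
    then have "0 < real n * slope g" by linarith
    then have "0 < slope g" by (simp add: zero_less_mult_iff)
    moreover have "slope x = slope y + slope g"
      using slope_mult[OF y g(1)] x y by (simp add: g_def flip: m_assoc)
    ultimately show False using le by simp
  qed
qed

end

theorem hoelder:
  obtains \<phi> :: "'a \<Rightarrow> real"
  where "\<And>x y. \<lbrakk>x \<in> carrier G; y \<in> carrier G\<rbrakk> \<Longrightarrow> \<phi> (x \<otimes> y) = \<phi> x + \<phi> y"
    and "\<And>x y. \<lbrakk>x \<in> carrier G; y \<in> carrier G\<rbrakk> \<Longrightarrow> x \<preceq> y \<longleftrightarrow> \<phi> x \<le> \<phi> y"
proof (cases "\<exists>e \<in> carrier G. \<one> \<prec> e")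
  case True
  then obtain e where e: "e \<in> carrier G" "\<one> \<prec> e" by blast
  show ?thesis
    by (rule that[of "slope e"]) (simp_all add: slope_mult[OF e] slope_le_iff[OF e])
next
  case False
  have "x \<preceq> y" if "x \<in> carrier G" "y \<in> carrier G" for x y
    using False that inv_mult_le_iff[of y x \<one>] by auto
  then show ?thesis using that[of "\<lambda>_. 0"] by simp
qed

end


section \<open>Subgroups of the reals\<close>

lemma group_real_group: "group real_group"
  by (rule groupI) (auto simp: real_group_def intro: exI[of _ "- x" for x])

lemma inv_real_group: "inv\<^bsub>real_group\<^esub> x = - x"
  by (rule group.inv_equality[OF group_real_group]) (auto simp: real_group_def)

lemma int_pow_real_group: "x [^]\<^bsub>real_group\<^esub> (n::int) = of_int n * x"
proof -
  have nat: "x [^]\<^bsub>real_group\<^esub> (k::nat) = real k * x" for k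
  proof (induction k)
    case 0
    show ?case by (simp add: real_group_def)
  next
    case (Suc k)
    have "x [^]\<^bsub>real_group\<^esub> Suc k = x [^]\<^bsub>real_group\<^esub> k + x" by (simp add: real_group_def)
    then show ?case using Suc by (simp add: algebra_simps)
  qed
  show ?thesis by (simp add: int_pow_def2 nat inv_real_group)
qed

lemma real_subgroup_archimedean:
  assumes "group Q" and s: "s \<subseteq> carrier Q \<times> carrier Q"
    and "order_isomorphic_to_real_subgroup Q s"
  shows "archimedean_ordered_group Q s"
proof -
  interpret Q: group Q by fact
  obtain S h where S: "subgroup S real_group" and h: "h \<in> iso Q (real_group\<lparr>carrier := S\<rparr>)"
    and ord: "\<And>x y. \<lbrakk>x \<in> carrier Q; y \<in> carrier Q\<rbrakk> \<Longrightarrow> (x, y) \<in> s \<longleftrightarrow> h x \<le> h y"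
    using assms(3) unfolding order_isomorphic_to_real_subgroup_def by blast
  have hom: "h \<in> hom Q real_group"
    using h by (auto simp: iso_def hom_def real_group_def)
  interpret h: group_hom Q real_group h
    using hom group_real_group by (simp add: group_hom_def group_hom_axioms_def Q.group_axioms)
  have inj: "h x = h y \<Longrightarrow> x = y" if "x \<in> carrier Q" "y \<in> carrier Q" for x y
    using h that by (auto simp: iso_def bij_betw_def dest: inj_onD)
  have mult: "h (x \<otimes>\<^bsub>Q\<^esub> y) = h x + h y" if "x \<in> carrier Q" "y \<in> carrier Q" for x y
    using h.hom_mult that by (simp add: real_group_def)
  have one: "h \<one>\<^bsub>Q\<^esub> = 0" using h.hom_one by (simp add: real_group_def)
  show ?thesis
  proof unfold_locales
    show "linear_order_on (carrier Q) s"
      unfolding linear_order_on_def partial_order_on_def preorder_on_def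
    proof (intro conjI)
      show "refl_on (carrier Q) s" using ord by (simp add: refl_on_def)
      show "trans s"
      proof (rule transI)
        fix x y z assume "(x, y) \<in> s" "(y, z) \<in> s"
        moreover from this have "x \<in> carrier Q" "y \<in> carrier Q" "z \<in> carrier Q" using s by auto
        ultimately show "(x, z) \<in> s" using ord by force
      qed
      show "antisym s"
      proof (rule antisymI)
        fix x y assume "(x, y) \<in> s" "(y, x) \<in> s"
        moreover from this have "x \<in> carrier Q" "y \<in> carrier Q" using s by auto
        ultimately show "x = y" using ord inj by force
      qed
      show "total_on (carrier Q) s" using ord by (auto simp: total_on_def)
    qed (rule s)
    fix g x y assume "g \<in> carrier Q" "(x, y) \<in> s"
    then show "(g \<otimes>\<^bsub>Q\<^esub> x, g \<otimes>\<^bsub>Q\<^esub> y) \<in> s" using ord mult s by force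
  next
    fix a b assume ab: "a \<in> carrier Q" "b \<in> carrier Q" "a \<noteq> \<one>\<^bsub>Q\<^esub>"
    then have "h a \<noteq> 0" using inj[of a "\<one>\<^bsub>Q\<^esub>"] one by auto
    obtain z :: int where z: "h b / \<bar>h a\<bar> < of_int z" using ex_less_of_int by blast
    define n where "n = (if 0 < h a then z else - z)"
    have "h b < of_int n * h a"
      using z \<open>h a \<noteq> 0\<close> by (auto simp: n_def field_simps abs_if split: if_splits)
    also have "\<dots> = h (a [^]\<^bsub>Q\<^esub> n)" using ab by (simp add: h.hom_int_pow int_pow_real_group)
    finally have "strict_rel s b (a [^]\<^bsub>Q\<^esub> n)" using ord ab by auto
    then show "\<exists>n::int. strict_rel s b (a [^]\<^bsub>Q\<^esub> n)" by blast
  qed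
qed


section \<open>The order on left cosets of a convex subgroup\<close>

context ordered_group
begin

lemma order_carrier: "(x, y) \<in> r \<Longrightarrow> x \<in> carrier G \<and> y \<in> carrier G"
  using linear_order by (auto simp: order_on_defs)

lemma order_refl: "x \<in> carrier G \<Longrightarrow> (x, x) \<in> r"
  using linear_order by (auto simp: order_on_defs refl_on_def)

lemma order_trans: "\<lbrakk>(x, y) \<in> r; (y, z) \<in> r\<rbrakk> \<Longrightarrow> (x, z) \<in> r"
  using linear_order by (auto simp: order_on_defs dest: transD)

lemma order_antisym: "\<lbrakk>(x, y) \<in> r; (y, x) \<in> r\<rbrakk> \<Longrightarrow> x = y"
  using linear_order by (auto simp: order_on_defs dest: antisymD)

lemma order_total: "\<lbrakk>x \<in> carrier G; y \<in> carrier G\<rbrakk> \<Longrightarrow> (x, y) \<in> r \<or> (y, x) \<in> r"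
  using linear_order order_refl by (cases "x = y") (auto simp: order_on_defs total_on_def)

lemma convexD:
  assumes "order_convex G r K" "x \<in> K" "z \<in> K" "(x, y) \<in> r" "(y, z) \<in> r"
  shows "y \<in> K"
  using assms order_carrier unfolding order_convex_def by blast

text \<open>
  Let \<open>t = x\<inverse>y\<close>, which is above \<open>\<one>\<close> and outside \<open>H\<close>. If \<open>yk \<le> xh\<close> with \<open>h, k \<in> H\<close>, then
  \<open>tk \<le> h\<close>. Either \<open>\<one> \<le> tk \<le> h\<close>, or \<open>tk \<le> \<one>\<close> and then \<open>k \<le> t\<inverse> \<le> \<one>\<close>; in both cases convexity
  puts \<open>t\<close> into \<open>H\<close>.
\<close>

lemma less_on_cosets:
  assumes H: "convex_subgroup G r H" and xy: "(x, y) \<in> r" "x <# H \<noteq> y <# H"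
    and x': "x' \<in> x <# H" and y': "y' \<in> y <# H"
  shows "strict_rel r x' y'"
proof -
  have sub: "subgroup H G" and conv: "order_convex G r H"
    using H by (auto simp: convex_subgroup_def)
  have G: "x \<in> carrier G" "y \<in> carrier G" using xy order_carrier by auto
  have HG: "h \<in> carrier G" if "h \<in> H" for h using subgroup.mem_carrier[OF sub that] .
  obtain h where h: "h \<in> H" "x' = x \<otimes> h" using x' by (auto simp: l_coset_def)
  obtain k where k: "k \<in> H" "y' = y \<otimes> k" using y' by (auto simp: l_coset_def)
  define t where "t = inv x \<otimes> y"
  have t: "t \<in> carrier G" "(\<one>, t) \<in> r"
    using left_invariant[of "inv x" x y] xy G by (auto simp: t_def)
  have tH: "t \<notin> H"
    using subgroup.lcos_module_rev[OF sub group_axioms G] l_repr_independence[OF _ G(1) sub]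
      xy(2) t_def by blast
  have "(y', x') \<notin> r"
  proof
    assume "(y', x') \<in> r"
    then have "(inv x \<otimes> y', inv x \<otimes> x') \<in> r" using left_invariant G by simp
    then have tk: "(t \<otimes> k, h) \<in> r" using G h k HG by (simp add: t_def m_assoc) (simp flip: m_assoc)
    show False
    proof (cases "(\<one>, t \<otimes> k) \<in> r")
      case True
      then have "t \<otimes> k \<in> H"
        using convexD[OF conv subgroup.one_closed[OF sub] h(1) _ tk] by blast
      then have "t \<otimes> k \<otimes> inv k \<in> H" using k sub by (simp add: subgroupE(3,4))
      then show False using tH t k HG by (simp add: m_assoc)
    next
      case False
      then have "(t \<otimes> k, \<one>) \<in> r" using order_total[of \<one> "t \<otimes> k"] t k HG by auto
      then have "(k, inv t) \<in> r"
        using left_invariant[of "inv t" "t \<otimes> k" \<one>] t k HG by (simp flip: m_assoc)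
      moreover have "(inv t, \<one>) \<in> r" using left_invariant[of "inv t" \<one> t] t by simp
      ultimately have "inv t \<in> H"
        using convexD[OF conv k(1) subgroup.one_closed[OF sub]] by blast
      then have "inv (inv t) \<in> H" using sub by (rule subgroupE(3)[rotated])
      then show False using tH t by simp
    qed
  qed
  moreover have "x' \<in> carrier G" "y' \<in> carrier G" using h k G HG by auto
  ultimately show ?thesis using order_total order_refl by blast
qed

lemma coset_order_iff:
  assumes H: "convex_subgroup G r H" and xy: "x \<in> carrier G" "y \<in> carrier G"
  shows "(x <# H, y <# H) \<in> coset_order G r H \<longleftrightarrow> x <# H = y <# H \<or> (x, y) \<in> r"
proof -
  have sub: "subgroup H G" using H by (simp add: convex_subgroup_def)
  have self: "a \<in> a <# H" if "a \<in> carrier G" for a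
    using subgroup.one_closed[OF sub] that by (force simp: l_coset_def)
  have "(x, y) \<in> r" if "a \<in> x <# H" "b \<in> y <# H" "strict_rel r a b" "x <# H \<noteq> y <# H" for a b
  proof (rule ccontr)
    assume "(x, y) \<notin> r"
    then have "(y, x) \<in> r" using order_total xy by blast
    then have "strict_rel r b a" using less_on_cosets[OF H _ _ that(2,1)] that(4) by simp
    then show False using that(3) order_antisym by blast
  qed
  moreover have "\<exists>a\<in>x <# H. \<exists>b\<in>y <# H. strict_rel r a b"
    if "(x, y) \<in> r" "x <# H \<noteq> y <# H"
    using self[OF xy(1)] self[OF xy(2)] that by blast
  moreover have "x <# H \<in> lcosets H" "y <# H \<in> lcosets H" using xy by (auto simp: LCOSETS_def)
  ultimately show ?thesis unfolding coset_order_def by blast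
qed

lemma coset_le_antisym:
  assumes "convex_subgroup G r H" "x \<in> carrier G" "y \<in> carrier G"
    and "(x <# H, y <# H) \<in> coset_order G r H" "(y <# H, x <# H) \<in> coset_order G r H"
  shows "x <# H = y <# H"
  using assms order_antisym by (auto simp: coset_order_iff)

lemma left_preordered_cosets:
  assumes H: "convex_subgroup G r H"
  shows "left_preordered_group G (\<lambda>x y. (x <# H, y <# H) \<in> coset_order G r H)"
proof unfold_locales
  have "H \<subseteq> carrier G" using H by (simp add: convex_subgroup_def order_convex_def)
  then show "(g \<otimes> x <# H, g \<otimes> y <# H) \<in> coset_order G r H"
    if "g \<in> carrier G" "x \<in> carrier G" "y \<in> carrier G" "(x <# H, y <# H) \<in> coset_order G r H"
    for g x y
  proof -
    have "g \<otimes> x <# H = g \<otimes> y <# H" if "x <# H = y <# H"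
      using lcos_m_assoc[OF \<open>H \<subseteq> carrier G\<close>, of g] that \<open>g \<in> carrier G\<close> \<open>x \<in> carrier G\<close> \<open>y \<in> carrier G\<close>
      by metis
    then show ?thesis using that left_invariant by (auto simp: coset_order_iff[OF H])
  qed
  fix x y z assume G: "x \<in> carrier G" "y \<in> carrier G" "z \<in> carrier G"
  show "(x <# H, y <# H) \<in> coset_order G r H \<or> (y <# H, x <# H) \<in> coset_order G r H"
    using order_total coset_order_iff[OF H] G by blast
  assume "(x <# H, y <# H) \<in> coset_order G r H" "(y <# H, z <# H) \<in> coset_order G r H"
  then show "(x <# H, z <# H) \<in> coset_order G r H"
    using order_trans coset_order_iff[OF H] G by metis
qed

text \<open>
  If \<open>f, g \<succ> \<one>\<close> and \<open>f g\<^sup>n \<preceq> g\<close> for all \<open>n\<close>, then \<open>u = H\<close>, \<open>v = f\<inverse>gH\<close> and \<open>w = g\<^sup>2H\<close>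
  give a crossing: the assumption for \<open>n + 1\<close> keeps \<open>g\<^sup>n u\<close> strictly below \<open>v\<close>, while
  \<open>g\<^sup>3 u\<close> is above \<open>w\<close>; and \<open>f\<close> sends \<open>v\<close> to \<open>gH\<close>, which is below \<open>w\<close>, whereas all
  \<open>f\<^sup>n v = f\<^sup>n\<^sup>-\<^sup>1 gH\<close> remain above \<open>u\<close>.
\<close>

lemma conradian_cosets:
  assumes H: "convex_subgroup G r H" and C: "conradian_extension G r H"
  shows "conradian_group G (\<lambda>x y. (x <# H, y <# H) \<in> coset_order G r H)"
proof -
  let ?le = "\<lambda>x y. (x <# H, y <# H) \<in> coset_order G r H"
  interpret left_preordered_group G ?le using H by (rule left_preordered_cosets)
  have HG: "H \<subseteq> carrier G" using H by (simp add: convex_subgroup_def order_convex_def)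
  have strict: "strict_rel (coset_order G r H) (x <# H) (y <# H)"
    if "\<not> ?le y x" "x \<in> carrier G" "y \<in> carrier G" for x y
    using that less_imp_le[of x y] by auto
  show ?thesis
  proof unfold_locales
    fix f g assume f: "f \<in> carrier G" "\<not> ?le f \<one>" and g: "g \<in> carrier G" "\<not> ?le g \<one>"
    show "\<exists>n::nat. \<not> ?le (f \<otimes> g [^] n) g"
    proof (rule ccontr)
      assume "\<not> ?thesis"
      then have bound: "?le (f \<otimes> g [^] n) g" for n :: nat by blast
      have step: "\<not> ?le (x \<otimes> g) x" if "x \<in> carrier G" for x
        using le_mult_right_iff(2)[of x g] that g by simp
      have cancel: "f \<otimes> (inv f \<otimes> g) = g" using f g by (simp flip: m_assoc)
      have g_pow: "\<not> ?le (inv f \<otimes> g) (g [^] n)" for n :: nat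
      proof -
        have "?le (f \<otimes> g [^] n \<otimes> g) g" using bound[of "Suc n"] f g by (simp add: m_assoc)
        then have "\<not> ?le g (f \<otimes> g [^] n)"
          using less_le_trans[OF step] f g by blast
        then show ?thesis using inv_mult_le_iff[of f g "g [^] n"] f g by blast
      qed
      have f_pow: "\<not> ?le (f [^] n \<otimes> (inv f \<otimes> g)) \<one>" if pos: "0 < n" for n :: nat
      proof -
        obtain m where m: "n = Suc m" using pos by (cases n) auto
        have "f [^] n \<otimes> (inv f \<otimes> g) = f [^] m \<otimes> g"
          using f(1) g(1) by (simp add: m m_assoc cancel)
        moreover have "?le \<one> (f [^] m)"
          using one_le_pow[OF f(1) less_imp_le[OF f(2)]] f by blast
        then have "\<not> ?le (f [^] m \<otimes> g) \<one>"
          using le_less_trans[OF _ step[of "f [^] m"]] f g by blast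
        ultimately show ?thesis by simp
      qed
      have below_v: "strict_rel (coset_order G r H)
          ((g [^] n) <# (\<one> <# H)) ((inv f \<otimes> g) <# H)" for n :: nat
        using strict[OF g_pow[of n]] f(1) g(1) by (simp add: lcos_m_assoc HG)
      have above_u: "strict_rel (coset_order G r H)
          (\<one> <# H) ((f [^] n) <# ((inv f \<otimes> g) <# H))" if "0 < n" for n :: nat
        using strict[OF f_pow[OF that]] f(1) g(1) by (simp add: lcos_m_assoc HG)
      have w: "strict_rel (coset_order G r H) (\<one> <# H) ((g [^] (2::nat)) <# H)"
          "strict_rel (coset_order G r H) ((g [^] (2::nat)) <# H) ((inv f \<otimes> g) <# H)"
        using strict[OF one_less_pow[of g 2]] strict[OF g_pow[of 2]] f(1) g by simp_all
      have f_below_w: "strict_rel (coset_order G r H)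
          ((f [^] (1::nat)) <# ((inv f \<otimes> g) <# H)) ((g [^] (2::nat)) <# H)"
        using strict[OF step[of g]] f(1) g(1)
        by (simp add: lcos_m_assoc HG numeral_2_eq_2 cancel)
      have g_above_w: "strict_rel (coset_order G r H)
          ((g [^] (2::nat)) <# H) ((g [^] (3::nat)) <# (\<one> <# H))"
        using strict[OF step[of "g [^] (2::nat)"]] g(1)
        by (simp add: lcos_m_assoc HG numeral_2_eq_2 numeral_3_eq_3)
      have "\<exists>(M::nat) (N::nat). M > 0 \<and> N > 0 \<and>
          strict_rel (coset_order G r H) ((f [^] N) <# ((inv f \<otimes> g) <# H)) ((g [^] (2::nat)) <# H) \<and>
          strict_rel (coset_order G r H) ((g [^] (2::nat)) <# H) ((g [^] M) <# (\<one> <# H))"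
        using f_below_w g_above_w by (intro exI[of _ 3] exI[of _ 1]) simp
      moreover have "x <# H \<in> lcosets H" if "x \<in> carrier G" for x
        using that by (auto simp: LCOSETS_def)
      ultimately have "crossing G (\<lambda>a C. a <# C) (lcosets H) (coset_order G r H)
          f g (\<one> <# H) ((inv f \<otimes> g) <# H) ((g [^] (2::nat)) <# H)"
        unfolding crossing_def using f(1) g(1) w below_v above_u by simp
      then show False using C by (auto simp: conradian_extension_def)
    qed
  qed
qed

text \<open>
  The convex subgroup of the elements dominated by \<open>b\<close> contains \<open>H\<close> by convexity for the coset
  preorder, and it contains \<open>b\<close>, which is not in \<open>H\<close>.
\<close>

lemma archimedean_cosets:
  assumes H: "convex_subgroup G r H" and C: "conradian_extension G r H"
    and maximal: "\<And>K. \<lbrakk>convex_subgroup G r K; H \<subset> K\<rbrakk> \<Longrightarrow> K = carrier G"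
  shows "archimedean_conradian_group G (\<lambda>x y. (x <# H, y <# H) \<in> coset_order G r H)"
proof -
  let ?le = "\<lambda>x y. (x <# H, y <# H) \<in> coset_order G r H"
  interpret conradian_group G ?le using H C by (rule conradian_cosets)
  have sub: "subgroup H G" using H by (simp add: convex_subgroup_def)
  show ?thesis
  proof unfold_locales
    fix b f assume b: "b \<in> carrier G" "\<not> ?le b \<one>" and f: "f \<in> carrier G"
    let ?K = "dominated_subgroup b"
    have K: "subgroup ?K G" using b by (rule dominated_subgroup_is_subgroup)
    have "order_convex G r ?K"
      unfolding order_convex_def
    proof (intro conjI ballI impI)
      show "?K \<subseteq> carrier G" using K by (rule subgroup.subset)
      fix x z y assume K': "x \<in> ?K" "z \<in> ?K" and y: "y \<in> carrier G"
        and xyz: "strict_rel r x y \<and> strict_rel r y z"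
      then have "?le x y" "?le y z" using order_carrier coset_order_iff[OF H] by blast+
      then show "y \<in> ?K" using dominated_subgroup_convex[OF b] K' y by blast
    qed
    moreover have "H \<subset> ?K"
    proof
      show "H \<subseteq> ?K"
      proof
        fix h assume h: "h \<in> H"
        then have hG: "h \<in> carrier G" using subgroup.mem_carrier[OF sub] by blast
        have "\<one> <# H = h <# H"
          using l_repr_independence[of h \<one> H] h hG sub lcos_mult_one[of H]
          by (simp add: subgroup.subset)
        then have "?le \<one> h" "?le h \<one>" using hG coset_order_iff[OF H] by auto
        then show "h \<in> ?K"
          using dominated_subgroup_convex[OF b] subgroup.one_closed[OF K] hG by blast
      qed
      show "H \<noteq> ?K"
      proof
        assume "H = ?K"
        then have "b \<in> H" using base_in_dominated_subgroup[OF b] by simp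
        then have "\<one> <# H = b <# H"
          using l_repr_independence[of b \<one> H] sub lcos_mult_one[of H] by (simp add: subgroup.subset)
        then show False using b coset_order_iff[OF H] by auto
      qed
    qed
    ultimately have "?K = carrier G" using maximal K by (simp add: convex_subgroup_def)
    then obtain m :: nat where m: "?le f (b [^] m)"
      using f by (auto simp: dominated_subgroup_def dominated_def)
    have "\<not> ?le (b [^] Suc m) (b [^] m)" using le_mult_right_iff(2)[of "b [^] m" b] b by simp
    then have "\<not> ?le (b [^] Suc m) f" using le_less_trans[OF m] f b by simp
    then show "\<exists>n::nat. \<not> ?le (b [^] n) f" by blast
  qed
qed

text \<open>
  An element is in the kernel of the Hoelder map exactly if it is equivalent to \<open>\<one>\<close>, that is,
  if it lies in \<open>H\<close>. Normality of \<open>H\<close> and the isomorphism onto a subgroup of the reals are then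
  the isomorphism theorem for this map.
\<close>

lemma conradian_quotient:
  assumes H: "convex_subgroup G r H" and C: "conradian_extension G r H"
    and maximal: "\<And>K. \<lbrakk>convex_subgroup G r K; H \<subset> K\<rbrakk> \<Longrightarrow> K = carrier G"
  shows "H \<lhd> G" and "order_isomorphic_to_real_subgroup (G Mod H) (coset_order G r H)"
proof -
  let ?le = "\<lambda>x y. (x <# H, y <# H) \<in> coset_order G r H"
  interpret A: archimedean_conradian_group G ?le using assms by (rule archimedean_cosets)
  interpret archimedean_bipreordered_group G ?le
    by unfold_locales (use A.right_mono A.archimedean in auto)
  obtain \<phi> :: "'a \<Rightarrow> real"
    where mult: "\<And>x y. \<lbrakk>x \<in> carrier G; y \<in> carrier G\<rbrakk> \<Longrightarrow> \<phi> (x \<otimes> y) = \<phi> x + \<phi> y"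
      and ord: "\<And>x y. \<lbrakk>x \<in> carrier G; y \<in> carrier G\<rbrakk> \<Longrightarrow> ?le x y \<longleftrightarrow> \<phi> x \<le> \<phi> y"
    using hoelder by blast
  have sub: "subgroup H G" using H by (simp add: convex_subgroup_def)
  let ?R = "real_group\<lparr>carrier := \<phi> ` carrier G\<rparr>"
  interpret R: group_hom G real_group \<phi>
    using mult group_real_group
    by (simp add: group_hom_def group_hom_axioms_def group_axioms hom_def real_group_def)
  interpret S: group_hom G ?R \<phi>
    using R.induced_group_hom[OF subgroup_self] by simp
  have zero: "\<phi> \<one> = 0" using R.hom_one by (simp add: real_group_def)
  have in_H: "x \<in> H \<longleftrightarrow> \<phi> x = 0" if x: "x \<in> carrier G" for x
  proof -
    have "x \<in> H \<longleftrightarrow> x <# H = \<one> <# H"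
    proof
      assume "x \<in> H"
      then show "x <# H = \<one> <# H"
        using l_repr_independence[of x \<one> H] sub lcos_mult_one[of H] by (simp add: subgroup.subset)
    next
      assume "x <# H = \<one> <# H"
      moreover have "x \<in> x <# H"
        using subgroup.one_closed[OF sub] x by (force simp: l_coset_def)
      ultimately show "x \<in> H" using lcos_mult_one[of H] sub by (simp add: subgroup.subset)
    qed
    also have "\<dots> \<longleftrightarrow> ?le x \<one> \<and> ?le \<one> x"
      using coset_le_antisym[OF H x one_closed] coset_order_iff[OF H] x by auto
    also have "\<dots> \<longleftrightarrow> \<phi> x = 0" using ord x zero by auto
    finally show ?thesis .
  qed
  have ker: "kernel G ?R \<phi> = H"
    using in_H subgroup.mem_carrier[OF sub] by (auto simp: kernel_def real_group_def)
  show normal: "H \<lhd> G" using S.normal_kernel unfolding ker .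
  have iso: "(\<lambda>C. the_elem (\<phi> ` C)) \<in> iso (G Mod H) ?R"
    using S.FactGroup_iso_set unfolding ker by simp
  have "(A, B) \<in> coset_order G r H \<longleftrightarrow> the_elem (\<phi> ` A) \<le> the_elem (\<phi> ` B)"
    if "A \<in> carrier (G Mod H)" "B \<in> carrier (G Mod H)" for A B
  proof -
    have rep: "\<exists>x\<in>carrier G. C = x <# H \<and> the_elem (\<phi> ` C) = \<phi> x"
      if C: "C \<in> carrier (G Mod H)" for C
    proof -
      obtain x where x: "x \<in> carrier G" "C = x <# H"
        using C normal.coset_eq[OF normal] by (auto simp: FactGroup_def RCOSETS_def)
      have "\<phi> y = \<phi> x" if y: "y \<in> C" for y
      proof -
        obtain h where h: "h \<in> H" "y = x \<otimes> h" using y x by (auto simp: l_coset_def)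
        have "h \<in> carrier G" using subgroup.mem_carrier[OF sub h(1)] .
        then show ?thesis using mult[OF x(1)] in_H h by simp
      qed
      moreover have "x \<in> C"
        using subgroup.one_closed[OF sub] x by (force simp: l_coset_def)
      ultimately have "\<phi> ` C = {\<phi> x}" by blast
      then show ?thesis using x by auto
    qed
    show ?thesis using rep[OF that(1)] rep[OF that(2)] ord by auto
  qed
  then show "order_isomorphic_to_real_subgroup (G Mod H) (coset_order G r H)"
    unfolding order_isomorphic_to_real_subgroup_def
    using iso R.img_is_subgroup by blast
qed

end


section \<open>Convex jumps\<close>

theorem theorem1p13:
  fixes \<Gamma> :: "('a, 'b) monoid_scheme" and r :: "('a \<times> 'a) set" and G H :: "'a set"
  assumes "ordered_group \<Gamma> r"
    and "convex_jump \<Gamma> r G H"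
    and "conradian_extension (\<Gamma>\<lparr>carrier := G\<rparr>) r H"
  shows "H \<lhd> \<Gamma>\<lparr>carrier := G\<rparr> \<and>
    archimedean_ordered_group
      ((\<Gamma>\<lparr>carrier := G\<rparr>) Mod H) (coset_order (\<Gamma>\<lparr>carrier := G\<rparr>) r H) \<and>
    order_isomorphic_to_real_subgroup
      ((\<Gamma>\<lparr>carrier := G\<rparr>) Mod H) (coset_order (\<Gamma>\<lparr>carrier := G\<rparr>) r H)"
proof -
  interpret \<Gamma>: ordered_group \<Gamma> r by fact
  let ?G = "\<Gamma>\<lparr>carrier := G\<rparr>"
  \<comment> \<open>A linear order on \<open>G\<close> must be a subset of \<open>G \<times> G\<close>, so \<open>r\<close> has to be restricted.\<close>
  define s where "s = r \<inter> G \<times> G"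
  have G: "subgroup G \<Gamma>" "order_convex \<Gamma> r G" and H: "subgroup H \<Gamma>" "order_convex \<Gamma> r H"
    and HG: "H \<subset> G"
    and jump: "\<And>K. \<lbrakk>convex_subgroup \<Gamma> r K; H \<subset> K; K \<subset> G\<rbrakk> \<Longrightarrow> False"
    using assms(2) unfolding convex_jump_def convex_subgroup_def by blast+
  have GG: "G \<subseteq> carrier \<Gamma>" using G(1) by (rule subgroup.subset)
  interpret S: ordered_group ?G s
  proof (intro ordered_group.intro ordered_group_axioms.intro)
    show "group ?G" using G(1) \<Gamma>.subgroup_imp_group by blast
    show "linear_order_on (carrier ?G) s"
      using \<Gamma>.linear_order GG unfolding order_on_defs s_def
      by (auto simp: refl_on_def total_on_def trans_def antisym_def)
        blast+
    show "(g \<otimes>\<^bsub>?G\<^esub> x, g \<otimes>\<^bsub>?G\<^esub> y) \<in> s" if "g \<in> carrier ?G" "(x, y) \<in> s" for g x y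
      using that \<Gamma>.left_invariant GG subgroup.m_closed[OF G(1)] by (auto simp: s_def)
  qed
  have convex: "convex_subgroup ?G s K \<longleftrightarrow> convex_subgroup \<Gamma> r K" if "K \<subseteq> G" for K
  proof -
    have "subgroup K ?G \<longleftrightarrow> subgroup K \<Gamma>"
      using \<Gamma>.incl_subgroup[OF G(1)] \<Gamma>.subgroup_incl[OF _ G(1) that] by blast
    moreover have "order_convex ?G s K \<longleftrightarrow> order_convex \<Gamma> r K"
    proof
      assume K: "order_convex ?G s K"
      show "order_convex \<Gamma> r K"
        unfolding order_convex_def
      proof (intro conjI ballI impI)
        show "K \<subseteq> carrier \<Gamma>" using that GG by blast
        fix x z y assume xz: "x \<in> K" "z \<in> K" and y: "y \<in> carrier \<Gamma>"
          and xyz: "strict_rel r x y \<and> strict_rel r y z"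
        then have "y \<in> G" using \<Gamma>.convexD[OF G(2), of x z y] that by blast
        then have "(x, y) \<in> s" "(y, z) \<in> s" using xz xyz that by (auto simp: s_def)
        then show "y \<in> K" using S.convexD[OF K xz] by blast
      qed
    next
      assume K: "order_convex \<Gamma> r K"
      show "order_convex ?G s K"
        unfolding order_convex_def
      proof (intro conjI ballI impI)
        show "K \<subseteq> carrier ?G" using that by simp
        fix x z y assume xz: "x \<in> K" "z \<in> K"
          and "strict_rel s x y \<and> strict_rel s y z"
        then have "(x, y) \<in> r" "(y, z) \<in> r" by (auto simp: s_def)
        then show "y \<in> K" using \<Gamma>.convexD[OF K xz] by blast
      qed
    qed
    ultimately show ?thesis by (simp add: convex_subgroup_def)
  qed
  have "C \<subseteq> G" if "C \<in> lcosets\<^bsub>?G\<^esub> H" for C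
    using that HG subgroup.m_closed[OF G(1)] by (auto simp: LCOSETS_def l_coset_def)
  then have order: "coset_order ?G s H = coset_order ?G r H"
    unfolding coset_order_def s_def by blast
  have "convex_subgroup ?G s H" using convex HG H by (simp add: convex_subgroup_def psubset_eq)
  moreover have "conradian_extension ?G s H"
    using assms(3) by (simp add: conradian_extension_def order)
  moreover have "K = carrier ?G" if "convex_subgroup ?G s K" "H \<subset> K" for K
  proof -
    have "K \<subseteq> G" using that(1) by (simp add: convex_subgroup_def order_convex_def)
    then show ?thesis using jump[of K] convex that by auto
  qed
  ultimately have normal: "H \<lhd> ?G"
    and iso: "order_isomorphic_to_real_subgroup (?G Mod H) (coset_order ?G s H)"
    using S.conradian_quotient by blast+
  have "lcosets\<^bsub>?G\<^esub> H = rcosets\<^bsub>?G\<^esub> H"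
    using normal.coset_eq[OF normal] by (simp add: LCOSETS_def RCOSETS_def)
  then have "coset_order ?G s H \<subseteq> carrier (?G Mod H) \<times> carrier (?G Mod H)"
    by (auto simp: coset_order_def FactGroup_def)
  then have "archimedean_ordered_group (?G Mod H) (coset_order ?G s H)"
    using real_subgroup_archimedean normal.factorgroup_is_group[OF normal] iso by blast
  then show ?thesis using normal iso by (simp only: order)
qed

end
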